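(* Let $a,b,c,d\in\mathbb{R}$ with $a>0$ and let $f(x):=ax^3+bx^2+cx+d$. Set $$x_0:=\frac{-b}{3a},\qquad p:=\frac{3ac-b^2}{3a^2},\qquad q:=\frac{27a^2d+2b^3-9abc}{27a^3},$$ $$\Delta:=(p/3)^3+(q/2)^2=\frac{(3ac-b^2)^3}{(9a^2)^3}+\frac{(27a^2d+2b^3-9abc)^2}{(54a^3)^2}.$$ Then $f$ is strictly concave on $\left]-\infty,x_0\right]$ and strictly convex on $\left[x_0,+\infty\right[$, and $x_0$ is the unique inflection point of $f$. Moreover, exactly one of the following cases occurs. (i) $b^2>3ac$ (equivalently $p<0$): Set $x_\pm:=(-b\pm\sqrt{b^2-3ac})/(3a)$. Then $x_\pm$ are two distinct simple roots of $f'$, $f$ is strictly increasing on $\left]-\infty,x_-\right]$, strictly decreasing on $[x_-,x_+]$, and strictly increasing on $\left[x_+,+\infty\right[$. This case trifurcates further as follows: (i)(a) $\Delta>0$: Then $f$ has exactly one real root; moreover, it is simple and given by $x_0+u_-+u_+$, where $u_\pm:=\sqrt[3]{\frac{-q}{2}\pm\sqrt{\Delta}}$. The two remaining simple nonreal roots are $x_0-\tfrac12(u_-+u_+)\pm \mathrm{i}\,\tfrac12\sqrt{3}(u_--u_+)$. (i)(b) $\Delta=0$: Then $f$ has two distinct real roots: the simple root is $$x_0+\frac{3q}{p}=x_0+2\sqrt[3]{\frac{-q}{2}}=\frac{4abc-b^3-9a^2d}{a(b^2-3ac)}$$ and the double root is $$x_0-\frac{3q}{2p}=x_0-\sqrt[3]{\frac{-q}{2}}=\frac{9ad-bc}{2(b^2-3ac)}.$$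 (i)(c) $\Delta<0$: Then $f$ has three simple real roots $r_-,r_0,r_+$ where $r_-<x_-<r_0<x_+<r_+$. Indeed, set $\theta:=\arccos\frac{-q/2}{(-p/3)^{3/2}}$, which lies in $\left]0,\pi\right[$, and define $y_0,y_1,y_2$ by $y_k:=x_0+2(-p/3)^{1/2}\cos\big(\frac{\theta+2k\pi}{3}\big)$. Then $r_-=y_1$, $r_0=y_2$, and $r_+=y_0$. (ii) $b^2=3ac$ (equivalently $p=0$): Then $f$ is strictly increasing on $\mathbb{R}$ and its only real root is $r:=x_0+(-q)^{1/3}$. If $q=0$, then $r$ is a triple root. If $q\neq0$, then $r$ is a simple root and the remaining nonreal simple roots are $x_0-\tfrac12(-q)^{1/3}\pm \mathrm{i}\,\tfrac12\sqrt{3}(-q)^{1/3}$. (iii) $b^2<3ac$ (equivalently $p>0$): Then $f$ is strictly increasing on $\mathbb{R}$, and $f$ has exactly one real root; moreover, it is simple and given by $x_0+u_-+u_+$, where $u_\pm:=\sqrt[3]{\frac{-q}{2}\pm\sqrt{\Delta}}$. The two remaining simple nonreal roots are $x_0-\tfrac12(u_-+u_+)\pm \mathrm{i}\,\tfrac12\sqrt{3}(u_--u_+)$.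
   Context: For real $t$, $\sqrt[3]{t}=t^{1/3}$ denotes the unique real cube root of $t$ (also for negative $t$). $\mathrm{i}$ is the imaginary unit; $\arccos$ takes values in $[0,\pi]$. A root is simple, double or triple if its multiplicity is $1$, $2$ or $3$. *)

theory Defs
  imports "HOL-Analysis.Analysis" "HOL-Computational_Algebra.Polynomial"
begin

definition strictly_convex_on :: "real set \<Rightarrow> (real \<Rightarrow> real) \<Rightarrow> bool" where
  "strictly_convex_on S f \<longleftrightarrow>
     convex S \<and>
     (\<forall>x\<in>S. \<forall>y\<in>S. \<forall>u>0. \<forall>v>0.
        x \<noteq> y \<longrightarrow> u + v = 1 \<longrightarrow> f (u * x + v * y) < u * f x + v * f y)"

definition strictly_concave_on :: "real set \<Rightarrow> (real \<Rightarrow> real) \<Rightarrow> bool" where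
  "strictly_concave_on S f \<longleftrightarrow> strictly_convex_on S (\<lambda>x. - f x)"

text \<open>A point of continuity at which the curvature changes sides. Strictness on both sides
  prevents points of affine pieces from counting as inflection points.\<close>

definition inflection_point :: "(real \<Rightarrow> real) \<Rightarrow> real \<Rightarrow> bool" where
  "inflection_point f x \<longleftrightarrow>
     isCont f x \<and>
     (\<exists>e>0. (strictly_concave_on {x - e..x} f \<and> strictly_convex_on {x..x + e} f) \<or>
            (strictly_convex_on {x - e..x} f \<and> strictly_concave_on {x..x + e} f))"

text \<open>Coefficient lists of polynomials are written in ascending order of degree.\<close>

lemma poly_cubic:
  fixes a b c d x :: real
  shows "poly [:d, c, b, a:] x = a * x ^ 3 + b * x ^ 2 + c * x + d"
  by (simp add: algebra_simps power2_eq_square power3_eq_cube)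

lemma poly_cubic_complex:
  fixes a b c d :: real and z :: complex
  shows "poly (map_poly complex_of_real [:d, c, b, a:]) z =
    of_real a * z ^ 3 + of_real b * z ^ 2 + of_real c * z + of_real d"
  by (simp add: map_poly_pCons algebra_simps power2_eq_square power3_eq_cube)

end

theory Submission
  imports Defs
begin

text \<open>
  Everything rests on completing the cube: with \<open>t = x - x0\<close> the polynomial becomes
  \<open>a * (t ^ 3 + p * t + q)\<close>, over the reals and over the complex numbers alike, and
  \<open>b ^ 2 - 3 * a * c = - (3 * a ^ 2) * p\<close>, so that the three cases are the three signs of \<open>p\<close>.

  The statements about shape are statements about signs of explicit forms. The gap between a chord
  and the graph is a positive multiple of a weighted sum of the two values of \<open>t\<close> at the ends
  (\<open>cubic_chord_gap\<close>), so its sign is that of \<open>t\<close>; this gives the curvature on either side of \<open>x0\<close>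
  and forces \<open>x0\<close> to be the only inflection point. The increment from \<open>s\<close> to a larger \<open>t\<close> is
  a positive multiple of \<open>s ^ 2 + s * t + t ^ 2 + p\<close> (\<open>cubic_difference\<close>), whose sign settles
  monotonicity.

  The roots come from explicit factorizations, and multiplicities are read off by counting
  linear factors (\<open>order_prod_linear_factors\<close>). If \<open>p = - 3 * u * v\<close> and
  \<open>q = - (u ^ 3 + v ^ 3)\<close>, then \<open>t ^ 3 + p * t + q\<close> has the factor \<open>t - (u + v)\<close> and a quadratic
  cofactor that is a sum of two squares (\<open>cardano_factorization\<close>). Cardano's radicals are such
  \<open>u\<close> and \<open>v\<close> as soon as \<open>\<Delta> \<ge> 0\<close>. For \<open>\<Delta> > 0\<close> they differ and the cofactor has two nonreal
  conjugate roots; for \<open>\<Delta> = 0\<close> they coincide and the cofactor is a square. The case \<open>p = 0\<close> is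
  the same factorization with \<open>v = 0\<close>, and degenerates to a cube when also \<open>q = 0\<close>. For \<open>\<Delta> < 0\<close> one scales by \<open>h = sqrt (- p / 3)\<close>: the triple
  angle formula turns \<open>t = 2 * h * cos \<phi>\<close> into the equation \<open>cos (3 * \<phi>) = (- q / 2) / h ^ 3\<close>, whose
  right-hand side lies strictly between \<open>-1\<close> and \<open>1\<close>. The three resulting roots are separated by
  the critical points \<open>x0 - h\<close> and \<open>x0 + h\<close>, hence distinct, hence all of the roots and simple.
\<close>

section \<open>Products of linear factors\<close>

lemma order_prod_linear_factors:
  fixes k :: "'a::field"
  assumes "k \<noteq> 0"
  shows "order x (smult k (\<Prod>r\<leftarrow>rs. [:- r, 1:])) = count_list rs x"
proof -
  have nz: "(\<Prod>r\<leftarrow>rs. [:- r, 1:]) \<noteq> 0" for rs :: "'a list"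
    by (auto simp: prod_list_zero_iff)
  have "order x (\<Prod>r\<leftarrow>rs. [:- r, 1:]) = count_list rs x"
  proof (induction rs)
    case Nil
    then show ?case by simp
  next
    case (Cons r rs)
    have "[:- r, 1:] * (\<Prod>r\<leftarrow>rs. [:- r, 1:]) \<noteq> 0"
      using nz[of rs] by (simp del: mult_pCons_left)
    moreover have "order x [:- r, 1:] = (if r = x then 1 else 0)"
      using order_power_n_n[of x 1] by (auto intro: order_0I)
    ultimately show ?case
      using Cons by (simp add: order_mult del: mult_pCons_left)
  qed
  then show ?thesis
    using assms by (simp add: order_smult)
qed

lemma roots_prod_linear_factors:
  fixes k :: "'a::field"
  assumes "k \<noteq> 0"
  shows "{x. poly (smult k (\<Prod>r\<leftarrow>rs. [:- r, 1:])) x = 0} = set rs"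
  using assms by (induction rs) (auto simp: algebra_simps)

text \<open>Over the reals the quadratic factor is positive, which leaves the linear factor alone. Over
  the complex numbers it is a difference of the squares of \<open>z - m\<close> and \<open>\<i> * n\<close>, and its two roots
  have nonzero imaginary parts \<open>n\<close> and \<open>- n\<close>, so all three linear factors are different.\<close>

lemma cubic_with_one_real_root:
  fixes k r m n :: real
  assumes "k \<noteq> 0" and "n \<noteq> 0"
    and f: "\<And>x. poly f x = k * ((x - r) * ((x - m) ^ 2 + n ^ 2))"
    and F: "\<And>z. poly F z = of_real k * ((z - of_real r) * ((z - of_real m) ^ 2 + of_real n ^ 2))"
    and zp: "zp = complex_of_real m + \<i> * complex_of_real n"
    and zm: "zm = complex_of_real m - \<i> * complex_of_real n"
  shows "{x. poly f x = 0} = {r} \<and> order r f = 1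
       \<and> {z. poly F z = 0 \<and> z \<notin> \<real>} = {zp, zm} \<and> zp \<noteq> zm
       \<and> order zp F = 1 \<and> order zm F = 1"
proof -
  have pos: "(x - m) ^ 2 + n ^ 2 > 0" for x
    using \<open>n \<noteq> 0\<close> by (simp add: add_nonneg_pos)
  define g where "g = smult k [:m ^ 2 + n ^ 2, - 2 * m, 1:]"
  have g: "poly g x = k * ((x - m) ^ 2 + n ^ 2)" for x
    by (simp add: g_def power2_eq_square algebra_simps)
  have "poly f = poly ([:- r, 1:] * g)"
    by (rule ext) (simp only: f poly_mult g, simp add: algebra_simps)
  then have fg: "f = [:- r, 1:] * g"
    by (simp only: poly_eq_poly_eq_iff)
  have "poly g r \<noteq> 0"
    using pos[of r] \<open>k \<noteq> 0\<close> unfolding g by auto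
  then have "order r g = 0" and "g \<noteq> 0"
    by (auto intro: order_0I)
  moreover have "order r [:- r, 1:] = 1"
    using order_power_n_n[of r 1] by simp
  moreover have "[:- r, 1:] * g \<noteq> 0"
    using \<open>g \<noteq> 0\<close> by (simp del: mult_pCons_left)
  ultimately have "order r f = 1"
    unfolding fg by (simp add: order_mult del: mult_pCons_left)
  moreover have "{x. poly f x = 0} = {r}"
    using pos \<open>k \<noteq> 0\<close> by (auto simp: f) (metis less_irrefl)
  moreover have im: "Im zp = n" "Im zm = - n"
    by (simp_all add: zp zm)
  moreover have "poly F = poly (smult (of_real k) (\<Prod>r\<leftarrow>[of_real r, zp, zm]. [:- r, 1:]))"
  proof (rule ext)
    fix z
    have "(z - zp) * (z - zm) = (z - of_real m) ^ 2 - (\<i> * of_real n) ^ 2"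
      by (simp add: zp zm power2_eq_square algebra_simps)
    then have "(z - zp) * (z - zm) = (z - of_real m) ^ 2 + of_real n ^ 2"
      by (simp add: power_mult_distrib)
    moreover have "poly (smult (of_real k) (\<Prod>r\<leftarrow>[of_real r, zp, zm]. [:- r, 1:])) z =
        of_real k * ((z - of_real r) * ((z - zp) * (z - zm)))"
      by (simp add: algebra_simps)
    ultimately show "poly F z = poly (smult (of_real k) (\<Prod>r\<leftarrow>[of_real r, zp, zm]. [:- r, 1:])) z"
      by (simp only: F)
  qed
  then have FF: "F = smult (of_real k) (\<Prod>r\<leftarrow>[of_real r, zp, zm]. [:- r, 1:])"
    by (simp only: poly_eq_poly_eq_iff)
  have k: "complex_of_real k \<noteq> 0"
    using \<open>k \<noteq> 0\<close> by simp
  have ne: "zp \<noteq> zm" "zp \<noteq> of_real r" "zm \<noteq> of_real r" "zp \<notin> \<real>" "zm \<notin> \<real>"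
    using im \<open>n \<noteq> 0\<close> by (auto simp: complex_is_Real_iff)
  have "poly F z = 0 \<longleftrightarrow> z \<in> {of_real r, zp, zm}" for z
    using roots_prod_linear_factors[OF k, of "[of_real r, zp, zm]"] unfolding FF by auto
  then have "{z. poly F z = 0 \<and> z \<notin> \<real>} = {zp, zm}"
    using ne by auto
  moreover have "order zp F = 1" "order zm F = 1"
    unfolding FF order_prod_linear_factors[OF k] using ne by auto
  ultimately show ?thesis
    using ne by blast
qed

section \<open>Curvature\<close>

lemma strictly_convex_on_subset:
  "strictly_convex_on S g \<Longrightarrow> convex T \<Longrightarrow> T \<subseteq> S \<Longrightarrow> strictly_convex_on T g"
  unfolding strictly_convex_on_def by blast

text \<open>The midpoint value would lie both below and above the midpoint of the chord.\<close>

lemma not_strictly_convex_and_concave: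
  assumes "l < (r::real)" "strictly_convex_on {l..r} g"
  shows "\<not> strictly_concave_on {l..r} g"
proof
  assume cc: "strictly_concave_on {l..r} g"
  have mid: "l \<in> {l..r}" "r \<in> {l..r}" "(0::real) < 1 / 2" "1 / 2 + 1 / 2 = (1::real)" "l \<noteq> r"
    using assms(1) by auto
  have "g (1 / 2 * l + 1 / 2 * r) < 1 / 2 * g l + 1 / 2 * g r"
    using assms(2) mid unfolding strictly_convex_on_def by blast
  moreover have "- g (1 / 2 * l + 1 / 2 * r) < 1 / 2 * (- g l) + 1 / 2 * (- g r)"
    using cc mid unfolding strictly_concave_on_def strictly_convex_on_def by blast
  ultimately show False by simp
qed

text \<open>Away from \<open>x0\<close> the curvature has the same strict sense on short intervals on both sides of
  a point, while an inflection point needs the opposite sense on one of them.\<close>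

lemma inflection_point_unique:
  assumes "isCont g x0"
    and cc: "strictly_concave_on {..x0} g" and cv: "strictly_convex_on {x0..} g"
  shows "inflection_point g x \<longleftrightarrow> x = x0"
proof -
  have cc': "strictly_concave_on {l..r} g" if "r \<le> x0" for l r
    using that cc unfolding strictly_concave_on_def
    by (auto intro: strictly_convex_on_subset)
  have cv': "strictly_convex_on {l..r} g" if "x0 \<le> l" for l r
    using that cv by (auto intro: strictly_convex_on_subset)
  show ?thesis
  proof
    assume "x = x0"
    then show "inflection_point g x"
      unfolding inflection_point_def using assms(1) cc' cv'
      by (intro conjI exI[of _ 1]) auto
  next
    assume "inflection_point g x"
    then obtain e where e: "e > 0"
      "strictly_concave_on {x - e..x} g \<and> strictly_convex_on {x..x + e} g \<or>
       strictly_convex_on {x - e..x} g \<and> strictly_concave_on {x..x + e} g"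
      unfolding inflection_point_def by blast
    show "x = x0"
    proof (rule ccontr)
      assume "x \<noteq> x0"
      then consider "x < x0" | "x > x0" by linarith
      then show False
      proof cases
        case 1
        \<comment> \<open>The interval is shortened so as not to cross \<open>x0\<close>.\<close>
        define h where "h = min e (x0 - x)"
        have h: "h > 0" "h \<le> e" "x + h \<le> x0"
          using 1 e by (auto simp: h_def)
        have "\<not> strictly_convex_on {x - e..x} g"
          using not_strictly_convex_and_concave[of "x - e" x] cc'[of x "x - e"] 1 e by auto
        moreover have "\<not> strictly_convex_on {x..x + e} g"
          using not_strictly_convex_and_concave[of x "x + h"] cc'[of "x + h" x] h
            strictly_convex_on_subset[of "{x..x + e}" g "{x..x + h}"] by auto
        ultimately show False using e by blast
      next
        case 2
        define h where "h = min e (x - x0)"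
        have h: "h > 0" "h \<le> e" "x - h \<ge> x0"
          using 2 e by (auto simp: h_def)
        have "\<not> strictly_concave_on {x..x + e} g"
          using not_strictly_convex_and_concave[of x "x + e"] cv'[of x "x + e"] 2 e by auto
        moreover have "\<not> strictly_concave_on {x - e..x} g"
          using not_strictly_convex_and_concave[of "x - h" x] cv'[of "x - h" x] h
            strictly_convex_on_subset[of "{x - e..x}" "\<lambda>x. - g x" "{x - h..x}"]
          by (auto simp: strictly_concave_on_def)
        ultimately show False using e by blast
      qed
    qed
  qed
qed

text \<open>The affine part of the cubic cancels, and what remains of \<open>u * s ^ 3 + v * t ^ 3 - (u * s + v * t) ^ 3\<close>
  contains \<open>(s - t) ^ 2\<close> and is linear otherwise. On one side of \<open>x0\<close> the sign of that linear factor
  is constant.\<close>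

lemma cubic_chord_gap:
  fixes a x0 p q x y u v :: real
  assumes "u + v = 1" and g: "\<And>x. g x = a * ((x - x0) ^ 3 + p * (x - x0) + q)"
  shows "u * g x + v * g y - g (u * x + v * y) =
    a * (u * v) * (x - y) ^ 2 * ((1 + u) * (x - x0) + (1 + v) * (y - x0))"
proof -
  have v: "v = 1 - u" using assms by simp
  show ?thesis unfolding v g by algebra
qed

lemma cubic_curvature:
  fixes a x0 p q :: real
  assumes "a > 0" and g: "\<And>x. g x = a * ((x - x0) ^ 3 + p * (x - x0) + q)"
  shows "strictly_concave_on {..x0} g" and "strictly_convex_on {x0..} g"
proof -
  have pos: "a * (u * v) * (x - y) ^ 2 > 0" if "u > 0" "v > 0" "x \<noteq> y" for u v x y
    using that \<open>a > 0\<close> by simp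
  have "- g (u * x + v * y) < u * (- g x) + v * (- g y)"
    if *: "x \<le> x0" "y \<le> x0" "u > 0" "v > 0" "x \<noteq> y" "u + v = 1" for u v x y
  proof -
    have "(1 + u) * (x - x0) \<le> 0" "(1 + v) * (y - x0) \<le> 0"
      using * by (auto intro: mult_nonneg_nonpos)
    moreover have "(1 + u) * (x - x0) \<noteq> 0 \<or> (1 + v) * (y - x0) \<noteq> 0"
      using * by auto
    ultimately have "(1 + u) * (x - x0) + (1 + v) * (y - x0) < 0"
      by linarith
    from mult_pos_neg[OF pos this] have "u * g x + v * g y - g (u * x + v * y) < 0"
      using * by (subst cubic_chord_gap[OF _ g]) auto
    then show ?thesis by simp
  qed
  then show "strictly_concave_on {..x0} g"
    unfolding strictly_concave_on_def strictly_convex_on_def by auto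
  have "g (u * x + v * y) < u * g x + v * g y"
    if *: "x \<ge> x0" "y \<ge> x0" "u > 0" "v > 0" "x \<noteq> y" "u + v = 1" for u v x y
  proof -
    have "(1 + u) * (x - x0) \<ge> 0" "(1 + v) * (y - x0) \<ge> 0"
      using * by auto
    moreover have "(1 + u) * (x - x0) \<noteq> 0 \<or> (1 + v) * (y - x0) \<noteq> 0"
      using * by auto
    ultimately have "(1 + u) * (x - x0) + (1 + v) * (y - x0) > 0"
      by linarith
    from mult_pos_pos[OF pos this] have "u * g x + v * g y - g (u * x + v * y) > 0"
      using * by (subst cubic_chord_gap[OF _ g]) auto
    then show ?thesis by simp
  qed
  then show "strictly_convex_on {x0..} g"
    unfolding strictly_convex_on_def by auto
qed

section \<open>Monotonicity\<close>

lemma cubic_difference: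
  fixes a x0 p q x y :: real
  assumes g: "\<And>x. g x = a * ((x - x0) ^ 3 + p * (x - x0) + q)"
  shows "g y - g x = a * (y - x) *
    ((x - x0) ^ 2 + (x - x0) * (y - x0) + (y - x0) ^ 2 + p)"
  unfolding g by algebra

lemma cubic_strict_mono:
  fixes a x0 p q :: real
  assumes "a > 0" and "p \<ge> 0" and g: "\<And>x. g x = a * ((x - x0) ^ 3 + p * (x - x0) + q)"
  shows "strict_mono g"
proof (rule strict_monoI)
  fix x y :: real
  assume "x < y"
  define s t where "s = x - x0" and "t = y - x0"
  \<comment> \<open>Completing the square in this way keeps \<open>t - s\<close>, which is known to be nonzero.\<close>
  have "s ^ 2 + s * t + t ^ 2 = (s + t) ^ 2 * (3 / 4) + (t - s) ^ 2 / 4"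
    by (simp add: power2_eq_square field_simps)
  also have "\<dots> > 0"
    using \<open>x < y\<close> by (intro add_nonneg_pos) (auto simp: s_def t_def)
  finally have "s ^ 2 + s * t + t ^ 2 + p > 0"
    using \<open>p \<ge> 0\<close> by simp
  then have "g y - g x > 0"
    using \<open>x < y\<close> \<open>a > 0\<close> unfolding cubic_difference[OF g] s_def t_def by simp
  then show "g x < g y" by simp
qed

text \<open>With \<open>s\<close> and \<open>t\<close> measured from \<open>x0\<close>, the question is on which side of \<open>3 * h ^ 2\<close> the form
  \<open>s ^ 2 + s * t + t ^ 2\<close> lies. On the right outer interval each summand is compared with \<open>h ^ 2\<close>. The left
  outer interval follows from the right one by the reflection \<open>(s, t) \<mapsto> (- t, - s)\<close>, which leaves
  the quadratic form fixed. On the inner interval the difference splits into products of the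
  factors \<open>s - h\<close>, \<open>s + h\<close>, \<open>t - h\<close>, \<open>t + h\<close>, whose signs are known.\<close>

lemma cubic_three_monotone_pieces:
  fixes a x0 p q h :: real
  assumes "a > 0" and "h > 0" and p: "p = - 3 * h ^ 2"
    and g: "\<And>x. g x = a * ((x - x0) ^ 3 + p * (x - x0) + q)"
  shows "strict_mono_on {..x0 - h} g"
    and "strict_antimono_on {x0 - h..x0 + h} g"
    and "strict_mono_on {x0 + h..} g"
proof -
  have gap: "s ^ 2 + s * t + t ^ 2 - 3 * h ^ 2 =
      (s - h) * (s + h) + (t - h) * (t + h) + (s * t - h ^ 2)" for s t :: real
    by algebra
  have up: "g x < g y"
    if "x < y" and pos: "(x - x0) ^ 2 + (x - x0) * (y - x0) + (y - x0) ^ 2 - 3 * h ^ 2 > 0" for x y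
  proof -
    have "g y - g x > 0"
      using that \<open>a > 0\<close> unfolding cubic_difference[OF g] p by simp
    then show ?thesis by simp
  qed
  have outer: "s ^ 2 + s * t + t ^ 2 - 3 * h ^ 2 > 0" if "h \<le> s" "s < t" for s t
  proof -
    have "h ^ 2 \<le> s ^ 2" using that \<open>h > 0\<close> by (intro power_mono) auto
    moreover have "s * s < s * t" using that \<open>h > 0\<close> by (intro mult_strict_left_mono) auto
    moreover have "s * t \<le> t * t" using that \<open>h > 0\<close> by (intro mult_right_mono) auto
    ultimately show ?thesis unfolding power2_eq_square by linarith
  qed
  show "strict_mono_on {x0 + h..} g"
    using outer by (auto intro!: strict_mono_onI up)
  show "strict_mono_on {..x0 - h} g"
  proof (rule strict_mono_onI, rule up)
    fix x y assume "x \<in> {..x0 - h}" "y \<in> {..x0 - h}" "x < y"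
    then show "(x - x0) ^ 2 + (x - x0) * (y - x0) + (y - x0) ^ 2 - 3 * h ^ 2 > 0"
      using outer[of "x0 - y" "x0 - x"] by (simp add: power2_eq_square algebra_simps)
  qed
  show "strict_antimono_on {x0 - h..x0 + h} g"
  proof (rule monotone_onI)
    fix x y assume *: "x \<in> {x0 - h..x0 + h}" "y \<in> {x0 - h..x0 + h}" "x < y"
    define s t where "s = x - x0" and "t = y - x0"
    have st: "- h \<le> s" "s < t" "t \<le> h" using * by (auto simp: s_def t_def)
    have "(s - h) * (s + h) \<le> 0" "(t - h) * (t + h) \<le> 0"
      using st by (auto intro: mult_nonpos_nonneg)
    \<comment> \<open>On the inner interval both products have nonpositive sign, and the first is strictly
    negative because \<open>s < t\<close> excludes \<open>s = h\<close> and \<open>t = - h\<close>.\<close>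
    moreover have "s * t - h ^ 2 = (s - h) * (t + h) / 2 + (s + h) * (t - h) / 2"
      by (simp add: power2_eq_square field_simps)
    moreover have "(s - h) * (t + h) < 0"
      using st by (intro mult_neg_pos) auto
    moreover have "(s + h) * (t - h) \<le> 0"
      using st by (intro mult_nonneg_nonpos) auto
    ultimately have "s ^ 2 + s * t + t ^ 2 - 3 * h ^ 2 < 0"
      unfolding gap by linarith
    then have "a * (y - x) * ((x - x0) ^ 2 + (x - x0) * (y - x0) + (y - x0) ^ 2 + p) < 0"
      using * \<open>a > 0\<close> unfolding p s_def t_def by (intro mult_pos_neg) auto
    then have "g y - g x < 0"
      unfolding cubic_difference[OF g] .
    then show "g x > g y" by simp
  qed
qed

section \<open>Roots\<close>

text \<open>The cofactor of \<open>t - (u + v)\<close> is \<open>t ^ 2 + (u + v) * t + (u ^ 2 - u * v + v ^ 2)\<close>, here with the square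
  completed. The element \<open>w\<close> is a square root of 3, so that the identity can be used over the reals and,
  with the image of \<open>sqrt 3\<close>, over the complex numbers.\<close>

lemma cardano_factorization:
  fixes u v :: "'a::field_char_0"
  assumes p: "p = - 3 * (u * v)" and q: "q = - (u ^ 3 + v ^ 3)" and w: "w ^ 2 = 3"
  shows "t ^ 3 + p * t + q = (t - (u + v)) * ((t + 1 / 2 * (u + v)) ^ 2 + (1 / 2 * w * (u - v)) ^ 2)"
proof -
  have sq: "(1 / 2 * w * (u - v)) ^ 2 = 3 / 4 * (u - v) ^ 2"
    using w by (simp add: power_mult_distrib power_divide)
  show ?thesis
    unfolding p q sq by (simp add: power2_eq_square power3_eq_cube field_simps)
qed

lemma cardano_one_real_root:
  fixes a x0 p q u v :: real
  assumes "a \<noteq> 0" and "u \<noteq> v" and p: "p = - 3 * (u * v)" and q: "q = - (u ^ 3 + v ^ 3)"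
    and f: "\<And>x. poly f x = a * ((x - x0) ^ 3 + p * (x - x0) + q)"
    and F: "\<And>z. poly F z = of_real a *
              ((z - of_real x0) ^ 3 + of_real p * (z - of_real x0) + of_real q)"
    and r: "r = x0 + u + v"
    and zp: "zp = complex_of_real (x0 - 1 / 2 * (u + v))
                    + \<i> * complex_of_real (1 / 2 * sqrt 3 * (u - v))"
    and zm: "zm = complex_of_real (x0 - 1 / 2 * (u + v))
                    - \<i> * complex_of_real (1 / 2 * sqrt 3 * (u - v))"
  shows "{x. poly f x = 0} = {r} \<and> order r f = 1
       \<and> {z. poly F z = 0 \<and> z \<notin> \<real>} = {zp, zm} \<and> zp \<noteq> zm
       \<and> order zp F = 1 \<and> order zm F = 1"
proof (rule cubic_with_one_real_root[OF \<open>a \<noteq> 0\<close> _ _ _ zp zm])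
  show "1 / 2 * sqrt 3 * (u - v) \<noteq> 0"
    using \<open>u \<noteq> v\<close> by simp
  have w: "sqrt 3 ^ 2 = (3::real)"
    by simp
  have shift: "x - x0 - (u + v) = x - r" "x - x0 + 1 / 2 * (u + v) = x - (x0 - 1 / 2 * (u + v))"
    for x by (simp_all add: r)
  show "poly f x = a * ((x - r) * ((x - (x0 - 1 / 2 * (u + v))) ^ 2
                     + (1 / 2 * sqrt 3 * (u - v)) ^ 2))" for x
    unfolding f cardano_factorization[OF p q w, of "x - x0"] shift ..
  have wc: "complex_of_real (sqrt 3) ^ 2 = 3"
    by (metis of_real_numeral of_real_power w)
  have pc: "complex_of_real p = - 3 * (of_real u * of_real v)"
    and qc: "complex_of_real q = - (of_real u ^ 3 + of_real v ^ 3)"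
    by (simp_all add: p q)
  have shiftc: "z - complex_of_real x0 - (of_real u + of_real v) = z - of_real r"
    "z - complex_of_real x0 + 1 / 2 * (of_real u + of_real v) = z - of_real (x0 - 1 / 2 * (u + v))"
    "1 / 2 * complex_of_real (sqrt 3) * (of_real u - of_real v) = of_real (1 / 2 * sqrt 3 * (u - v))"
    for z by (simp_all add: r field_simps)
  show "poly F z = of_real a * ((z - of_real r) * ((z - of_real (x0 - 1 / 2 * (u + v))) ^ 2
                     + of_real (1 / 2 * sqrt 3 * (u - v)) ^ 2))" for z
    unfolding F cardano_factorization[OF pc qc wc, of "z - of_real x0"] shiftc ..
qed

text \<open>The radicands have sum \<open>- q\<close> and product \<open>(q / 2) ^ 2 - \<Delta> = (- p / 3) ^ 3\<close>. The real cube root is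
  multiplicative, so no choice of branch intervenes in the product of the radicals.\<close>

lemma cardano_radicals:
  fixes p q \<Delta> :: real
  assumes "\<Delta> \<ge> 0" and \<Delta>: "\<Delta> = (p / 3) ^ 3 + (q / 2) ^ 2"
    and u: "u = root 3 (- q / 2 - sqrt \<Delta>)" and v: "v = root 3 (- q / 2 + sqrt \<Delta>)"
  shows "p = - 3 * (u * v)" and "q = - (u ^ 3 + v ^ 3)" and "u = v \<longleftrightarrow> \<Delta> = 0"
proof -
  have "u * v = root 3 ((- q / 2 - sqrt \<Delta>) * (- q / 2 + sqrt \<Delta>))"
    by (simp add: u v real_root_mult)
  also have "(- q / 2 - sqrt \<Delta>) * (- q / 2 + sqrt \<Delta>) = (q / 2) ^ 2 - sqrt \<Delta> ^ 2"
    by (simp add: power2_eq_square algebra_simps)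
  also have "\<dots> = (- p / 3) ^ 3"
    using \<open>\<Delta> \<ge> 0\<close> by (simp add: \<Delta> power3_eq_cube)
  also have "root 3 \<dots> = - p / 3"
    by (rule odd_real_root_power_cancel) simp
  finally show "p = - 3 * (u * v)" by simp
  have "u ^ 3 = - q / 2 - sqrt \<Delta>" "v ^ 3 = - q / 2 + sqrt \<Delta>"
    unfolding u v by (rule odd_real_root_pow; simp)+
  then show "q = - (u ^ 3 + v ^ 3)" by simp
  show "u = v \<longleftrightarrow> \<Delta> = 0" by (simp add: u v)
qed

text \<open>Subtracting the equations of two roots and dividing by the difference of the roots gives a
  quadratic relation; doing the same with two such relations gives \<open>r + s + t = 0\<close>. The
  remaining Vieta relations follow.\<close>

lemma depressed_cubic_three_roots:
  fixes r s t p q :: real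
  assumes "r \<noteq> s" "r \<noteq> t" "s \<noteq> t"
    and roots: "r ^ 3 + p * r + q = 0" "s ^ 3 + p * s + q = 0" "t ^ 3 + p * t + q = 0"
  shows "x ^ 3 + p * x + q = (x - r) * (x - s) * (x - t)"
proof -
  have "(r - s) * (r ^ 2 + r * s + s ^ 2 + p) = 0" "(r - t) * (r ^ 2 + r * t + t ^ 2 + p) = 0"
    using roots by algebra+
  then have rs: "r ^ 2 + r * s + s ^ 2 + p = 0" and rt: "r ^ 2 + r * t + t ^ 2 + p = 0"
    using assms by auto
  then have "(s - t) * (r + s + t) = 0" by algebra
  then have "t = - r - s" using assms by auto
  with rs roots(1) show ?thesis by algebra
qed

lemma triple_angle_root:
  fixes h \<phi> q :: real
  assumes "q = - 2 * h ^ 3 * cos (3 * \<phi>)"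
  shows "(2 * h * cos \<phi>) ^ 3 + (- 3 * h ^ 2) * (2 * h * cos \<phi>) + q = 0"
  unfolding assms cos_treble_cos by algebra

text \<open>The points of division are \<open>x0 + 2 * h * cos (pi / 3) = x0 + h\<close> and \<open>x0 + 2 * h * cos (2 * pi / 3) = x0 - h\<close>.
  The angles of \<open>y 0\<close> and \<open>y 1\<close> lie in the first and the last third of \<open>[0, pi]\<close>; the angle of
  \<open>y 2\<close> is beyond \<open>pi\<close>, and reflecting it at \<open>pi\<close> brings it to the middle third, where the
  monotonicity of the cosine decides.\<close>

lemma trigonometric_roots_located:
  fixes \<theta> :: real and y :: "nat \<Rightarrow> real"
  assumes "h > 0" and "0 < \<theta>" "\<theta> < pi"
    and y: "\<And>k. y k = x0 + 2 * h * cos ((\<theta> + 2 * real k * pi) / 3)"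
  shows "y 1 < x0 - h" and "x0 - h < y 2" and "y 2 < x0 + h" and "x0 + h < y 0"
proof -
  have c: "cos (2 * pi / 3) = - (1 / 2)"
    using cos_120' by (simp add: mult.commute)
  have mono: "cos \<beta> < cos \<alpha>" if "0 \<le> \<alpha>" "\<alpha> < \<beta>" "\<beta> \<le> pi" for \<alpha> \<beta> :: real
    using that by (rule cos_monotone_0_pi)
  have scale: "2 * h * \<alpha> < 2 * h * \<beta>" if "\<alpha> < \<beta>" for \<alpha> \<beta>
    using that \<open>h > 0\<close> by simp
  have "cos (pi / 3) < cos (\<theta> / 3)"
    using assms by (intro mono) auto
  from scale[OF this] show "x0 + h < y 0"
    by (simp add: y cos_60)
  have "cos ((\<theta> + 2 * pi) / 3) < cos (2 * pi / 3)"
    using assms by (intro mono) auto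
  from scale[OF this] show "y 1 < x0 - h"
    by (simp add: y c)
  have mirror: "cos ((\<theta> + 4 * pi) / 3) = cos ((2 * pi - \<theta>) / 3)"
    using cos_2pi_minus[of "(2 * pi - \<theta>) / 3"] by (simp add: field_simps)
  have "cos (2 * pi / 3) < cos ((2 * pi - \<theta>) / 3)" "cos ((2 * pi - \<theta>) / 3) < cos (pi / 3)"
    using assms by (intro mono; simp)+
  from this[THEN scale] show "x0 - h < y 2" "y 2 < x0 + h"
    by (simp_all add: y mirror cos_60 c)
qed

text \<open>The condition on the discriminant says \<open>\<bar>q / 2\<bar> < h ^ 3\<close>, so the arccosine is taken strictly inside
  its domain. Adding \<open>2 * k * pi\<close> does not change \<open>cos \<theta>\<close>, and a third of it leads to the other
  two roots.\<close>

lemma cubic_three_real_roots: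
  fixes a x0 p q h \<theta> :: real and y :: "nat \<Rightarrow> real"
  assumes "a \<noteq> 0" and "h > 0" and p: "p = - 3 * h ^ 2" and "(p / 3) ^ 3 + (q / 2) ^ 2 < 0"
    and f: "\<And>x. poly f x = a * ((x - x0) ^ 3 + p * (x - x0) + q)"
    and \<theta>: "\<theta> = arccos ((- q / 2) / h ^ 3)"
    and y: "\<And>k. y k = x0 + 2 * h * cos ((\<theta> + 2 * real k * pi) / 3)"
  shows "\<theta> \<in> {0<..<pi}"
    and "y 1 < x0 - h" and "x0 - h < y 2" and "y 2 < x0 + h" and "x0 + h < y 0"
    and "{x. poly f x = 0} = {y 1, y 2, y 0}"
    and "order (y 1) f = 1" and "order (y 2) f = 1" and "order (y 0) f = 1"
proof -
  have "(q / 2) ^ 2 < (h ^ 3) ^ 2"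
    using assms(4) by (simp add: p power_mult[symmetric])
  then have "\<bar>q / 2\<bar> < h ^ 3"
    using \<open>h > 0\<close> by (metis abs_le_square_iff abs_of_pos not_le zero_less_power)
  then have "- 1 < (- q / 2) / h ^ 3" "(- q / 2) / h ^ 3 < 1"
    using \<open>h > 0\<close> by (simp_all add: field_simps abs_less_iff)
  then have bounds: "0 < \<theta>" "\<theta> < pi" and cos\<theta>: "cos \<theta> = (- q / 2) / h ^ 3"
    unfolding \<theta> using arccos_lt_bounded by auto
  then show "\<theta> \<in> {0<..<pi}" by simp
  note loc = trigonometric_roots_located[OF \<open>h > 0\<close> bounds y]
  then show "y 1 < x0 - h" "x0 - h < y 2" "y 2 < x0 + h" "x0 + h < y 0" by simp_all
  have root: "(y k - x0) ^ 3 + p * (y k - x0) + q = 0" for k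
  proof -
    have "3 * ((\<theta> + 2 * real k * pi) / 3) = \<theta> + 2 * real k * pi"
      by simp
    moreover have "cos (\<theta> + 2 * real k * pi) = cos \<theta>"
      by (simp add: cos_add)
    ultimately have "q = - 2 * h ^ 3 * cos (3 * ((\<theta> + 2 * real k * pi) / 3))"
      using cos\<theta> \<open>h > 0\<close> by (simp only:) simp
    from triple_angle_root[OF this] show ?thesis
      by (simp add: y p)
  qed
  have distinct: "y 1 \<noteq> y 2" "y 1 \<noteq> y 0" "y 2 \<noteq> y 0"
    using loc \<open>h > 0\<close> by linarith+
  have "poly f = poly (smult a (\<Prod>r\<leftarrow>[y 1, y 2, y 0]. [:- r, 1:]))"
  proof (rule ext)
    fix x
    have "poly f x = a * ((x - y 1) * (x - y 2) * (x - y 0))"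
      using depressed_cubic_three_roots[OF _ _ _ root[of 1] root[of 2] root[of 0], of "x - x0"] distinct
      by (simp add: f)
    then show "poly f x = poly (smult a (\<Prod>r\<leftarrow>[y 1, y 2, y 0]. [:- r, 1:])) x"
      by (simp add: algebra_simps)
  qed
  then have fac: "f = smult a (\<Prod>r\<leftarrow>[y 1, y 2, y 0]. [:- r, 1:])"
    by (simp only: poly_eq_poly_eq_iff)
  show "{x. poly f x = 0} = {y 1, y 2, y 0}"
    unfolding fac roots_prod_linear_factors[OF \<open>a \<noteq> 0\<close>] by simp
  show "order (y 1) f = 1" "order (y 2) f = 1" "order (y 0) f = 1"
    unfolding fac order_prod_linear_factors[OF \<open>a \<noteq> 0\<close>] using distinct by auto
qed

text \<open>This is the shape of a cubic in which Cardano's two radicals have the common value \<open>w\<close>.\<close>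

lemma cubic_double_root:
  fixes a x0 w :: real
  assumes "a \<noteq> 0" and "w \<noteq> 0"
    and f: "\<And>x. poly f x = a * ((x - x0) ^ 3 + (- 3 * w ^ 2) * (x - x0) + (- 2 * w ^ 3))"
  shows "{x. poly f x = 0} = {x0 + 2 * w, x0 - w}"
    and "order (x0 + 2 * w) f = 1" and "order (x0 - w) f = 2"
proof -
  have "poly f = poly (smult a (\<Prod>r\<leftarrow>[x0 + 2 * w, x0 - w, x0 - w]. [:- r, 1:]))"
    by (rule ext) (simp add: f power2_eq_square power3_eq_cube algebra_simps)
  then have fac: "f = smult a (\<Prod>r\<leftarrow>[x0 + 2 * w, x0 - w, x0 - w]. [:- r, 1:])"
    by (simp only: poly_eq_poly_eq_iff)
  show "{x. poly f x = 0} = {x0 + 2 * w, x0 - w}"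
    unfolding fac roots_prod_linear_factors[OF \<open>a \<noteq> 0\<close>] by simp
  show "order (x0 + 2 * w) f = 1" "order (x0 - w) f = 2"
    unfolding fac order_prod_linear_factors[OF \<open>a \<noteq> 0\<close>] using \<open>w \<noteq> 0\<close> by auto
qed

lemma cubic_triple_root:
  fixes a x0 :: real
  assumes "a \<noteq> 0" and f: "\<And>x. poly f x = a * (x - x0) ^ 3"
  shows "{x. poly f x = 0} = {x0}" and "order x0 f = 3"
proof -
  have "poly f = poly (smult a (\<Prod>r\<leftarrow>[x0, x0, x0]. [:- r, 1:]))"
    by (rule ext) (simp add: f power3_eq_cube algebra_simps)
  then have fac: "f = smult a (\<Prod>r\<leftarrow>[x0, x0, x0]. [:- r, 1:])"
    by (simp only: poly_eq_poly_eq_iff)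
  show "{x. poly f x = 0} = {x0}"
    unfolding fac roots_prod_linear_factors[OF \<open>a \<noteq> 0\<close>] by simp
  show "order x0 f = 3"
    unfolding fac order_prod_linear_factors[OF \<open>a \<noteq> 0\<close>] by simp
qed

section \<open>The general cubic\<close>

theorem theorem3p1:
  fixes a b c d x0 p q \<Delta> :: real
    and f :: "real poly"
    and F :: "complex poly"
  assumes "a > 0"
    and "f = [:d, c, b, a:]"
    and "F = map_poly complex_of_real f"
    and "x0 = - b / (3 * a)"
    and "p = (3 * a * c - b ^ 2) / (3 * a ^ 2)"
    and "q = (27 * a ^ 2 * d + 2 * b ^ 3 - 9 * a * b * c) / (27 * a ^ 3)"
    and "\<Delta> = (p / 3) ^ 3 + (q / 2) ^ 2"
  shows
    "\<Delta> = (3 * a * c - b ^ 2) ^ 3 / (9 * a ^ 2) ^ 3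
          + (27 * a ^ 2 * d + 2 * b ^ 3 - 9 * a * b * c) ^ 2 / (54 * a ^ 3) ^ 2
     \<and> strictly_concave_on {..x0} (poly f)
     \<and> strictly_convex_on {x0..} (poly f)
     \<and> (\<forall>x. inflection_point (poly f) x \<longleftrightarrow> x = x0)
     \<and> (b ^ 2 > 3 * a * c \<or> b ^ 2 = 3 * a * c \<or> b ^ 2 < 3 * a * c)
     \<and> \<not> (b ^ 2 > 3 * a * c \<and> b ^ 2 = 3 * a * c)
     \<and> \<not> (b ^ 2 > 3 * a * c \<and> b ^ 2 < 3 * a * c)
     \<and> \<not> (b ^ 2 = 3 * a * c \<and> b ^ 2 < 3 * a * c)
     \<and> (b ^ 2 > 3 * a * c \<longleftrightarrow> p < 0)
     \<and> (b ^ 2 = 3 * a * c \<longleftrightarrow> p = 0)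
     \<and> (b ^ 2 < 3 * a * c \<longleftrightarrow> p > 0)
     \<and> (b ^ 2 > 3 * a * c \<longrightarrow>
          (let xm = (- b - sqrt (b ^ 2 - 3 * a * c)) / (3 * a);
               xp = (- b + sqrt (b ^ 2 - 3 * a * c)) / (3 * a)
           in xm \<noteq> xp
            \<and> order xm (pderiv f) = 1 \<and> order xp (pderiv f) = 1
            \<and> strict_mono_on {..xm} (poly f)
            \<and> strict_antimono_on {xm..xp} (poly f)
            \<and> strict_mono_on {xp..} (poly f)
            \<and> (\<Delta> > 0 \<or> \<Delta> = 0 \<or> \<Delta> < 0)
            \<and> \<not> (\<Delta> > 0 \<and> \<Delta> = 0) \<and> \<not> (\<Delta> > 0 \<and> \<Delta> < 0) \<and> \<not> (\<Delta> = 0 \<and> \<Delta> < 0)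
            \<and> (\<Delta> > 0 \<longrightarrow>
                (let um = root 3 (- q / 2 - sqrt \<Delta>);
                     up = root 3 (- q / 2 + sqrt \<Delta>);
                     r = x0 + um + up;
                     zp = complex_of_real (x0 - 1 / 2 * (um + up))
                          + \<i> * complex_of_real (1 / 2 * sqrt 3 * (um - up));
                     zm = complex_of_real (x0 - 1 / 2 * (um + up))
                          - \<i> * complex_of_real (1 / 2 * sqrt 3 * (um - up))
                 in {x. poly f x = 0} = {r} \<and> order r f = 1
                  \<and> {z. poly F z = 0 \<and> z \<notin> \<real>} = {zp, zm} \<and> zp \<noteq> zm
                  \<and> order zp F = 1 \<and> order zm F = 1))
            \<and> (\<Delta> = 0 \<longrightarrow>
                (let s = x0 + 3 * q / p;
                     t = x0 - 3 * q / (2 * p)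
                 in s = x0 + 2 * root 3 (- q / 2)
                  \<and> s = (4 * a * b * c - b ^ 3 - 9 * a ^ 2 * d) / (a * (b ^ 2 - 3 * a * c))
                  \<and> t = x0 - root 3 (- q / 2)
                  \<and> t = (9 * a * d - b * c) / (2 * (b ^ 2 - 3 * a * c))
                  \<and> {x. poly f x = 0} = {s, t} \<and> s \<noteq> t
                  \<and> order s f = 1 \<and> order t f = 2))
            \<and> (\<Delta> < 0 \<longrightarrow>
                (let \<theta> = arccos ((- q / 2) / (- p / 3) powr (3 / 2));
                     y = (\<lambda>k::nat. x0 + 2 * (- p / 3) powr (1 / 2)
                                        * cos ((\<theta> + 2 * real k * pi) / 3))
                 in \<theta> \<in> {0<..<pi}
                  \<and> (\<exists>rm r0 rp.
                       {x. poly f x = 0} = {rm, r0, rp}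
                     \<and> order rm f = 1 \<and> order r0 f = 1 \<and> order rp f = 1
                     \<and> rm < xm \<and> xm < r0 \<and> r0 < xp \<and> xp < rp
                     \<and> rm = y 1 \<and> r0 = y 2 \<and> rp = y 0)))))
     \<and> (b ^ 2 = 3 * a * c \<longrightarrow>
          strict_mono (poly f)
          \<and> (let r = x0 + root 3 (- q);
                 zp = complex_of_real (x0 - 1 / 2 * root 3 (- q))
                      + \<i> * complex_of_real (1 / 2 * sqrt 3 * root 3 (- q));
                 zm = complex_of_real (x0 - 1 / 2 * root 3 (- q))
                      - \<i> * complex_of_real (1 / 2 * sqrt 3 * root 3 (- q))
             in {x. poly f x = 0} = {r}
              \<and> (q = 0 \<longrightarrow> order r f = 3)
              \<and> (q \<noteq> 0 \<longrightarrow>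
                   order r f = 1
                   \<and> {z. poly F z = 0 \<and> z \<notin> \<real>} = {zp, zm} \<and> zp \<noteq> zm
                   \<and> order zp F = 1 \<and> order zm F = 1)))
     \<and> (b ^ 2 < 3 * a * c \<longrightarrow>
          strict_mono (poly f)
          \<and> (let um = root 3 (- q / 2 - sqrt \<Delta>);
                 up = root 3 (- q / 2 + sqrt \<Delta>);
                 r = x0 + um + up;
                 zp = complex_of_real (x0 - 1 / 2 * (um + up))
                      + \<i> * complex_of_real (1 / 2 * sqrt 3 * (um - up));
                 zm = complex_of_real (x0 - 1 / 2 * (um + up))
                      - \<i> * complex_of_real (1 / 2 * sqrt 3 * (um - up))
             in {x. poly f x = 0} = {r} \<and> order r f = 1
              \<and> {z. poly F z = 0 \<and> z \<notin> \<real>} = {zp, zm} \<and> zp \<noteq> zm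
              \<and> order zp F = 1 \<and> order zm F = 1))"
proof -
  have "a \<noteq> 0" using \<open>a > 0\<close> by simp
  \<comment> \<open>The coefficients in terms of \<open>x0\<close>, \<open>p\<close>, \<open>q\<close>: from here on all identities are polynomial.\<close>
  have bcd: "b = - 3 * a * x0" "c = a * (3 * x0 ^ 2 + p)" "d = a * (q - p * x0 - x0 ^ 3)"
    unfolding assms(4-6) using \<open>a \<noteq> 0\<close>
    by (simp_all add: power2_eq_square power3_eq_cube field_simps)
  have f: "poly f x = a * ((x - x0) ^ 3 + p * (x - x0) + q)" for x
    unfolding assms(2) poly_cubic bcd by algebra
  have F: "poly F z = of_real a * ((z - of_real x0) ^ 3 + of_real p * (z - of_real x0) + of_real q)"
    for z
    unfolding assms(2,3) poly_cubic_complex bcd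
    by (simp add: power2_eq_square power3_eq_cube algebra_simps)
  have disc: "b ^ 2 - 3 * a * c = - (3 * a ^ 2) * p"
    unfolding bcd by algebra
  have "3 * a ^ 2 > 0" using \<open>a > 0\<close> by simp
  then have trichotomy: "b ^ 2 > 3 * a * c \<longleftrightarrow> p < 0" "b ^ 2 = 3 * a * c \<longleftrightarrow> p = 0"
      "b ^ 2 < 3 * a * c \<longleftrightarrow> p > 0"
    using disc by (smt (verit) mult_neg_neg mult_neg_pos mult_eq_0_iff)+
  have \<Delta>_abcd: "\<Delta> = (3 * a * c - b ^ 2) ^ 3 / (9 * a ^ 2) ^ 3
          + (27 * a ^ 2 * d + 2 * b ^ 3 - 9 * a * b * c) ^ 2 / (54 * a ^ 3) ^ 2"
  proof -
    have "p / 3 = (3 * a * c - b ^ 2) / (9 * a ^ 2)"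
      "q / 2 = (27 * a ^ 2 * d + 2 * b ^ 3 - 9 * a * b * c) / (54 * a ^ 3)"
      by (simp_all add: assms(5,6))
    then show ?thesis
      by (simp only: assms(7) power_divide)
  qed
  note curvature = cubic_curvature[OF \<open>a > 0\<close> f]
  have inflection: "\<forall>x. inflection_point (poly f) x \<longleftrightarrow> x = x0"
    using inflection_point_unique[OF _ curvature] by simp
  have mono: "strict_mono (poly f)" if "p \<ge> 0"
    using cubic_strict_mono[OF \<open>a > 0\<close> that f] .

  have one_root: "let um = root 3 (- q / 2 - sqrt \<Delta>);
                     up = root 3 (- q / 2 + sqrt \<Delta>);
                     r = x0 + um + up;
                     zp = complex_of_real (x0 - 1 / 2 * (um + up))
                          + \<i> * complex_of_real (1 / 2 * sqrt 3 * (um - up));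
                     zm = complex_of_real (x0 - 1 / 2 * (um + up))
                          - \<i> * complex_of_real (1 / 2 * sqrt 3 * (um - up))
                 in {x. poly f x = 0} = {r} \<and> order r f = 1
                  \<and> {z. poly F z = 0 \<and> z \<notin> \<real>} = {zp, zm} \<and> zp \<noteq> zm
                  \<and> order zp F = 1 \<and> order zm F = 1" if "\<Delta> > 0"
  proof -
    note rad = cardano_radicals[OF less_imp_le[OF that] assms(7) refl refl]
    from rad(3) that have "root 3 (- q / 2 - sqrt \<Delta>) \<noteq> root 3 (- q / 2 + sqrt \<Delta>)"
      by simp
    from cardano_one_real_root[OF \<open>a \<noteq> 0\<close> this rad(1,2) f F refl refl refl]
    show ?thesis unfolding Let_def .
  qed

  have critical: "let xm = (- b - sqrt (b ^ 2 - 3 * a * c)) / (3 * a);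
               xp = (- b + sqrt (b ^ 2 - 3 * a * c)) / (3 * a)
           in xm \<noteq> xp
            \<and> order xm (pderiv f) = 1 \<and> order xp (pderiv f) = 1
            \<and> strict_mono_on {..xm} (poly f)
            \<and> strict_antimono_on {xm..xp} (poly f)
            \<and> strict_mono_on {xp..} (poly f)
            \<and> xm = x0 - sqrt (- p / 3) \<and> xp = x0 + sqrt (- p / 3)" if "p < 0"
  proof -
    define h where "h = sqrt (- p / 3)"
    have "h > 0" and p: "p = - 3 * h ^ 2"
      using that by (simp_all add: h_def)
    have "sqrt (b ^ 2 - 3 * a * c) = sqrt ((3 * a * h) ^ 2)"
      unfolding disc p by (simp add: power_mult_distrib)
    then have "sqrt (b ^ 2 - 3 * a * c) = 3 * a * h"
      using \<open>a > 0\<close> \<open>h > 0\<close> by simp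
    then have xm: "(- b - sqrt (b ^ 2 - 3 * a * c)) / (3 * a) = x0 - h"
      and xp: "(- b + sqrt (b ^ 2 - 3 * a * c)) / (3 * a) = x0 + h"
      using \<open>a > 0\<close> by (simp_all add: bcd(1) field_simps)
    have "3 * a \<noteq> 0" using \<open>a > 0\<close> by simp
    have derivative: "pderiv f = smult (3 * a) (\<Prod>r\<leftarrow>[x0 - h, x0 + h]. [:- r, 1:])"
      unfolding assms(2) bcd p by (simp add: pderiv_pCons power2_eq_square algebra_simps)
    have "order (x0 - h) (pderiv f) = 1" "order (x0 + h) (pderiv f) = 1"
      unfolding derivative order_prod_linear_factors[OF \<open>3 * a \<noteq> 0\<close>] using \<open>h > 0\<close> by auto
    moreover note cubic_three_monotone_pieces[OF \<open>a > 0\<close> \<open>h > 0\<close> p f]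
    ultimately show ?thesis
      unfolding Let_def xm xp h_def[symmetric] using \<open>h > 0\<close> by simp
  qed

  have double_root: "let s = x0 + 3 * q / p;
                     t = x0 - 3 * q / (2 * p)
                 in s = x0 + 2 * root 3 (- q / 2)
                  \<and> s = (4 * a * b * c - b ^ 3 - 9 * a ^ 2 * d) / (a * (b ^ 2 - 3 * a * c))
                  \<and> t = x0 - root 3 (- q / 2)
                  \<and> t = (9 * a * d - b * c) / (2 * (b ^ 2 - 3 * a * c))
                  \<and> {x. poly f x = 0} = {s, t} \<and> s \<noteq> t
                  \<and> order s f = 1 \<and> order t f = 2" if "p < 0" "\<Delta> = 0"
  proof -
    define w where "w = root 3 (- q / 2)"
    have p: "p = - 3 * w ^ 2" and q: "q = - 2 * w ^ 3"
      using cardano_radicals(1,2)[OF _ assms(7) refl refl] that(2)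
      by (simp_all add: w_def power2_eq_square)
    have "w \<noteq> 0" using that(1) p by auto
    have s: "x0 + 3 * q / p = x0 + 2 * w" and t: "x0 - 3 * q / (2 * p) = x0 - w"
      using \<open>w \<noteq> 0\<close> by (simp_all add: p q power2_eq_square power3_eq_cube)
    have "x0 + 3 * q / p = (4 * a * b * c - b ^ 3 - 9 * a ^ 2 * d) / (a * (b ^ 2 - 3 * a * c))"
    proof -
      have numerator: "4 * a * b * c - b ^ 3 - 9 * a ^ 2 * d = - (3 * a ^ 3) * (p * x0 + 3 * q)"
        unfolding bcd by algebra
      show ?thesis
        unfolding disc numerator using \<open>a \<noteq> 0\<close> that(1)
        by (simp add: power2_eq_square power3_eq_cube field_simps)
    qed
    moreover have "x0 - 3 * q / (2 * p) = (9 * a * d - b * c) / (2 * (b ^ 2 - 3 * a * c))"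
    proof -
      have numerator: "9 * a * d - b * c = - (3 * a ^ 2) * (2 * p * x0 - 3 * q)"
        unfolding bcd by algebra
      show ?thesis
        unfolding disc numerator using \<open>a \<noteq> 0\<close> that(1)
        by (simp add: power2_eq_square field_simps)
    qed
    moreover note cubic_double_root[OF \<open>a \<noteq> 0\<close> \<open>w \<noteq> 0\<close> f[unfolded p q]]
    ultimately show ?thesis
      unfolding Let_def s t w_def[symmetric] using \<open>w \<noteq> 0\<close> by simp
  qed

  have three_roots: "let xm = (- b - sqrt (b ^ 2 - 3 * a * c)) / (3 * a);
               xp = (- b + sqrt (b ^ 2 - 3 * a * c)) / (3 * a);
               \<theta> = arccos ((- q / 2) / (- p / 3) powr (3 / 2));
                     y = (\<lambda>k::nat. x0 + 2 * (- p / 3) powr (1 / 2)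
                                        * cos ((\<theta> + 2 * real k * pi) / 3))
                 in \<theta> \<in> {0<..<pi}
                  \<and> (\<exists>rm r0 rp.
                       {x. poly f x = 0} = {rm, r0, rp}
                     \<and> order rm f = 1 \<and> order r0 f = 1 \<and> order rp f = 1
                     \<and> rm < xm \<and> xm < r0 \<and> r0 < xp \<and> xp < rp
                     \<and> rm = y 1 \<and> r0 = y 2 \<and> rp = y 0)" if "p < 0" "\<Delta> < 0"
  proof -
    define h where "h = sqrt (- p / 3)"
    have "h > 0" and p: "p = - 3 * h ^ 2"
      using that by (simp_all add: h_def)
    have half: "(- p / 3) powr (1 / 2) = h"
      using that by (simp add: h_def powr_half_sqrt)
    have "(- p / 3) powr (3 / 2) = ((- p / 3) powr (1 / 2)) powr 3"
      by (simp add: powr_powr)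
    also have "\<dots> = h ^ 3"
      unfolding half using \<open>h > 0\<close> by simp
    finally have three_halves: "(- p / 3) powr (3 / 2) = h ^ 3" .
    define y where "y = (\<lambda>k::nat. x0 + 2 * h * cos ((arccos ((- q / 2) / h ^ 3) + 2 * real k * pi) / 3))"
    have "(p / 3) ^ 3 + (q / 2) ^ 2 < 0"
      using that assms(7) by simp
    note roots = cubic_three_real_roots[OF \<open>a \<noteq> 0\<close> \<open>h > 0\<close> p this f refl y_def[THEN fun_cong]]
    have "(- b - sqrt (b ^ 2 - 3 * a * c)) / (3 * a) = x0 - h"
      "(- b + sqrt (b ^ 2 - 3 * a * c)) / (3 * a) = x0 + h"
      using critical[OF that(1)] by (simp_all only: Let_def h_def)
    then show ?thesis
      unfolding Let_def half three_halves
      using roots unfolding y_def by (simp only: ) blast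
  qed

  have flat: "let r = x0 + root 3 (- q);
                 zp = complex_of_real (x0 - 1 / 2 * root 3 (- q))
                      + \<i> * complex_of_real (1 / 2 * sqrt 3 * root 3 (- q));
                 zm = complex_of_real (x0 - 1 / 2 * root 3 (- q))
                      - \<i> * complex_of_real (1 / 2 * sqrt 3 * root 3 (- q))
             in {x. poly f x = 0} = {r}
              \<and> (q = 0 \<longrightarrow> order r f = 3)
              \<and> (q \<noteq> 0 \<longrightarrow>
                   order r f = 1
                   \<and> {z. poly F z = 0 \<and> z \<notin> \<real>} = {zp, zm} \<and> zp \<noteq> zm
                   \<and> order zp F = 1 \<and> order zm F = 1)" if "p = 0"
  proof (cases "q = 0")
    case True
    then have "poly f x = a * (x - x0) ^ 3" for x
      using f that by simp
    from cubic_triple_root[OF \<open>a \<noteq> 0\<close> this] True show ?thesis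
      by (simp add: Let_def)
  next
    case False
    define u where "u = root 3 (- q)"
    have "u \<noteq> 0" "p = - 3 * (u * 0)" "q = - (u ^ 3 + 0 ^ 3)"
      using False that by (simp_all add: u_def odd_real_root_pow)
    \<comment> \<open>Cardano's factorization with the second radical equal to 0.\<close>
    from cardano_one_real_root[OF \<open>a \<noteq> 0\<close> this f F refl refl refl] False show ?thesis
      unfolding Let_def u_def[symmetric] by (simp only: add_0_right diff_0_right) simp
  qed

  have \<Delta>_pos: "\<Delta> > 0" if "p > 0"
    using that unfolding assms(7) by (intro add_pos_nonneg) auto
  note one_root = one_root[unfolded Let_def] and critical = critical[unfolded Let_def]
    and double_root = double_root[unfolded Let_def] and three_roots = three_roots[unfolded Let_def]
    and flat = flat[unfolded Let_def]
  have signs: "t < 0 \<or> t = 0 \<or> t > 0" "t > 0 \<or> t = 0 \<or> t < 0"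
    "\<not> (t < 0 \<and> t = 0)" "\<not> (t < 0 \<and> t > 0)" "\<not> (t = 0 \<and> t > 0)"
    "\<not> (t > 0 \<and> t = 0)" "\<not> (t > 0 \<and> t < 0)" "\<not> (t = 0 \<and> t < 0)" for t :: real
    by auto
  \<comment> \<open>In terms of the sign of \<open>p\<close>, every remaining conjunct occurs in one of the facts above.\<close>
  show ?thesis
    unfolding trichotomy Let_def
    by (intro conjI impI;
        (fact \<Delta>_abcd curvature inflection | rule refl signs | rule mono, simp |
         frule critical, elim conjE, assumption |
         frule one_root, elim conjE, assumption |
         frule (1) double_root, elim conjE, assumption |
         frule (1) three_roots, elim conjE, assumption |
         frule flat, elim conjE, assumption |
         frule flat, elim conjE, drule (1) mp, assumption |
         frule flat, elim conjE, drule (1) mp, elim conjE, assumption |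
         frule one_root[OF \<Delta>_pos], elim conjE, assumption))
qed

end
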